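(* Let $w = x_1^2[x_1^{-2}, x_2^{-1}]^2$, a word in the free group $F_2$ on $x_1,x_2$. Then the word map $(x,y) \mapsto w(x,y)$ is non-surjective on $\mathrm{PSL}_2(p^{2r+1})$ for all non-negative integers $r$ and all odd primes $p \neq 5$ such that $p^2 \not\equiv 1 \bmod 16$ and $p^2 \not\equiv 1 \bmod 5$.
   Context: Commutator convention: $[a,b] = a^{-1}b^{-1}ab$, so $[x_1^{-2},x_2^{-1}] = x_1^{2}x_2x_1^{-2}x_2^{-1}$. For a group $G$ and a word $w = w(x_1,x_2)\in F_2$, the word map on $G$ is the map $G\times G \to G$, $(x,y)\mapsto w(x,y)$, obtained by substituting $x$ for $x_1$ and $y$ for $x_2$; it is non-surjective on $G$ if its image is not all of $G$. $\mathrm{PSL}_2(q)=\mathrm{SL}_2(\mathbb{F}_q)/\{\pm I\}$. *)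

theory Defs
  imports
    "HOL-Analysis.Determinants"
    "HOL-Algebra.Coset"
    "HOL-Number_Theory.Cong"
    "HOL-Computational_Algebra.Primes"
begin

section \<open>Free groups\<close>

text \<open>A letter \<open>(g, True)\<close> stands for the generator \<open>g\<close> and \<open>(g, False)\<close> for its inverse.
  The elements of the free group are the freely reduced words.\<close>

definition flip :: "'g \<times> bool \<Rightarrow> 'g \<times> bool" where
  "flip a = (fst a, \<not> snd a)"

fun push :: "'g \<times> bool \<Rightarrow> ('g \<times> bool) list \<Rightarrow> ('g \<times> bool) list" where
  "push a [] = [a]"
| "push a (b # u) = (if b = flip a then u else a # b # u)"

definition reduced :: "('g \<times> bool) list \<Rightarrow> bool" where
  "reduced u \<longleftrightarrow> successively (\<lambda>a b. b \<noteq> flip a) u"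

definition free_group :: "('g \<times> bool) list monoid" where
  "free_group = \<lparr>carrier = {u. reduced u}, mult = foldr push, one = []\<rparr>"

definition gen :: "'g \<Rightarrow> ('g \<times> bool) list" where
  "gen g = [(g, True)]"

lemma flip_flip [simp]: "flip (flip a) = a"
  by (simp add: flip_def)

lemma flip_neq [simp]: "flip a \<noteq> a"
  by (simp add: flip_def prod_eq_iff)

lemma flip_inject [simp]: "flip a = flip b \<longleftrightarrow> a = b"
  by (metis flip_flip)

lemma reduced_Nil [simp]: "reduced []"
  by (simp add: reduced_def)

lemma reduced_Cons: "reduced (a # u) \<longleftrightarrow> u = [] \<or> (hd u \<noteq> flip a \<and> reduced u)"
  by (cases u) (auto simp: reduced_def)

lemma reduced_push: "reduced u \<Longrightarrow> reduced (push a u)"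
  by (cases u) (auto simp: reduced_Cons)

lemma reduced_foldr_push: "reduced v \<Longrightarrow> reduced (foldr push u v)"
  by (induction u) (auto simp: reduced_push)

lemma push_push_flip: "reduced u \<Longrightarrow> push a (push (flip a) u) = u"
  by (cases u; cases "tl u") (auto simp: reduced_Cons)

lemma foldr_push_push:
  assumes "reduced z"
  shows "foldr push (push a v) z = push a (foldr push v z)"
  using assms by (cases v) (auto simp: push_push_flip reduced_foldr_push)

lemma foldr_push_assoc:
  assumes "reduced z"
  shows "foldr push (foldr push u v) z = foldr push u (foldr push v z)"
  using assms by (induction u) (auto simp: foldr_push_push)

lemma foldr_push_Nil: "reduced u \<Longrightarrow> foldr push u [] = u"
proof (induction u)
  case (Cons a u)
  then show ?case by (cases u) (auto simp: reduced_Cons)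
qed simp

lemma foldr_push_inverse: "foldr push (map flip (rev u)) u = []"
  by (induction u) auto

lemma reduced_inverse: "reduced u \<Longrightarrow> reduced (map flip (rev u))"
  unfolding reduced_def successively_map successively_rev
  by (erule successively_mono) (metis flip_flip)

lemma group_free_group: "group free_group"
proof (rule groupI)
  fix u :: "('g \<times> bool) list"
  assume "u \<in> carrier free_group"
  then have "map flip (rev u) \<in> carrier free_group"
    by (simp add: free_group_def reduced_inverse)
  then show "\<exists>v\<in>carrier free_group. v \<otimes>\<^bsub>free_group\<^esub> u = \<one>\<^bsub>free_group\<^esub>"
    using foldr_push_inverse[of u] by (auto simp: free_group_def)
qed (auto simp: free_group_def reduced_foldr_push foldr_push_assoc)

lemma gen_closed: "gen g \<in> carrier free_group"
  by (simp add: free_group_def gen_def reduced_Cons)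


section \<open>Word maps\<close>

definition word_eval :: "('a, 'm) monoid_scheme \<Rightarrow> ('g \<Rightarrow> 'a) \<Rightarrow> ('g \<times> bool) list \<Rightarrow> 'a" where
  "word_eval G f u =
    foldr (\<lambda>a z. (if snd a then f (fst a) else inv\<^bsub>G\<^esub> f (fst a)) \<otimes>\<^bsub>G\<^esub> z) u \<one>\<^bsub>G\<^esub>"

datatype letter2 = X1 | X2

type_synonym word2 = "(letter2 \<times> bool) list"

abbreviation F2 :: "word2 monoid" where
  "F2 \<equiv> free_group"

definition word_map :: "('a, 'm) monoid_scheme \<Rightarrow> word2 \<Rightarrow> 'a \<times> 'a \<Rightarrow> 'a" where
  "word_map G u = (\<lambda>(x, y). word_eval G (case_letter2 x y) u)"

definition commutator :: "('a, 'm) monoid_scheme \<Rightarrow> 'a \<Rightarrow> 'a \<Rightarrow> 'a" where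
  "commutator G a b = inv\<^bsub>G\<^esub> a \<otimes>\<^bsub>G\<^esub> inv\<^bsub>G\<^esub> b \<otimes>\<^bsub>G\<^esub> a \<otimes>\<^bsub>G\<^esub> b"

definition w :: word2 where
  "w = gen X1 [^]\<^bsub>F2\<^esub> (2::nat) \<otimes>\<^bsub>F2\<^esub>
    commutator F2 (gen X1 [^]\<^bsub>F2\<^esub> (-2::int)) (inv\<^bsub>F2\<^esub> gen X2) [^]\<^bsub>F2\<^esub> (2::nat)"

context group
begin

lemma word_eval_closed:
  assumes "range f \<subseteq> carrier G"
  shows "word_eval G f u \<in> carrier G"
  using assms by (induction u) (auto simp: word_eval_def)

lemma word_eval_push:
  assumes f: "range f \<subseteq> carrier G"
  shows "word_eval G f (push a u) = word_eval G f [a] \<otimes> word_eval G f u"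
proof (cases u)
  case Nil
  have "f g \<in> carrier G" for g using f by auto
  then show ?thesis unfolding Nil by (simp add: word_eval_def)
next
  case (Cons b v)
  have "f g \<in> carrier G" for g using f by auto
  moreover have "word_eval G f v \<in> carrier G" using f by (rule word_eval_closed)
  ultimately show ?thesis
    unfolding Cons by (auto simp: word_eval_def flip_def m_assoc[symmetric])
qed

lemma word_eval_hom:
  assumes f: "range f \<subseteq> carrier G"
  shows "word_eval G f \<in> hom free_group G"
proof -
  have f': "f g \<in> carrier G" for g using f by auto
  have "word_eval G f (foldr push u v) = word_eval G f u \<otimes> word_eval G f v" for u v
  proof (induction u)
    case Nil
    then show ?case using word_eval_closed[OF f] by (simp add: word_eval_def)
  next
    case (Cons a u)
    have "word_eval G f (a # u) = word_eval G f [a] \<otimes> word_eval G f u"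
      using f' word_eval_closed[OF f, of u] by (simp add: word_eval_def)
    with Cons show ?case
      by (simp add: word_eval_push[OF f] m_assoc word_eval_closed[OF f])
  qed
  then show ?thesis
    by (auto simp: hom_def free_group_def word_eval_closed[OF f])
qed

lemma word_eval_gen: "range f \<subseteq> carrier G \<Longrightarrow> word_eval G f (gen g) = f g"
  by (simp add: word_eval_def gen_def image_subset_iff)

end

lemma hom_commutator:
  assumes "group G" "group H" "h \<in> hom G H" "a \<in> carrier G" "b \<in> carrier G"
  shows "h (commutator G a b) = commutator H (h a) (h b)"
proof -
  interpret group_hom G H h
    using assms by (simp add: group_hom_def group_hom_axioms_def)
  show ?thesis using assms by (simp add: commutator_def)
qed

lemma word_map_w:
  assumes "group G" and x: "x \<in> carrier G" and y: "y \<in> carrier G"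
  shows "word_map G w (x, y) =
    x [^]\<^bsub>G\<^esub> (2::nat) \<otimes>\<^bsub>G\<^esub>
    commutator G (x [^]\<^bsub>G\<^esub> (-2::int)) (inv\<^bsub>G\<^esub> y) [^]\<^bsub>G\<^esub> (2::nat)"
proof -
  let ?f = "case_letter2 x y" and ?h = "word_eval G (case_letter2 x y)"
  interpret G: group G by fact
  interpret F: group F2 by (rule group_free_group)
  have f: "range ?f \<subseteq> carrier G"
    using x y by (auto split: letter2.splits)
  interpret group_hom F2 G ?h
    using G.word_eval_hom[OF f] by unfold_locales
  have c: "commutator F2 a b \<in> carrier F2" if "a \<in> carrier F2" "b \<in> carrier F2" for a b
    using that by (simp add: commutator_def)
  show ?thesis
    unfolding word_map_def w_def
    using f hom_commutator[OF F.is_group G.is_group homh]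
    by (simp add: c gen_closed hom_nat_pow hom_int_pow G.word_eval_gen
        del: F.int_pow_neg_int)
qed


section \<open>The groups SL(2) and PSL(2)\<close>

definition SL2 :: "('a::field^2^2) monoid" where
  "SL2 = \<lparr>carrier = {A. det A = 1}, mult = (**), one = mat 1\<rparr>"

definition PSL2 :: "('a::field^2^2) set monoid" where
  "PSL2 = SL2 Mod {mat 1, - mat 1}"

lemma det_uminus_2: "det (- A) = det (A :: 'a::comm_ring_1^2^2)"
  by (simp add: det_2)

lemma matrix_mul_uminus: "(- A) ** B = - (A ** B)" "A ** (- B) = - (A ** B)"
  for A B :: "'a::comm_ring_1^2^2"
  by (simp_all add: matrix_matrix_mult_def vec_eq_iff sum_2)

lemma group_SL2: "group (SL2 :: ('a::field^2^2) monoid)"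
proof (rule groupI)
  fix A :: "'a^2^2"
  assume A: "A \<in> carrier SL2"
  then have "invertible A" by (simp add: SL2_def invertible_det_nz)
  then obtain B where B: "B ** A = mat 1" by (auto simp: invertible_def)
  then have "det B * det A = 1" by (metis det_I det_mul)
  with A have "B \<in> carrier SL2" by (simp add: SL2_def)
  with B show "\<exists>B\<in>carrier SL2. B \<otimes>\<^bsub>SL2\<^esub> A = \<one>\<^bsub>SL2\<^esub>"
    by (auto simp: SL2_def)
qed (auto simp: SL2_def det_mul matrix_mul_assoc)

lemma normal_SL2_center: "{mat 1, - mat 1} \<lhd> (SL2 :: ('a::field^2^2) monoid)"
proof -
  interpret group "SL2 :: ('a^2^2) monoid" by (rule group_SL2)
  let ?Z = "{mat 1, - mat 1} :: ('a^2^2) set"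
  have sub: "subgroup ?Z SL2"
  proof (rule subgroupI)
    have "inv\<^bsub>SL2\<^esub> (- mat 1 :: 'a^2^2) = - mat 1"
      by (rule inv_equality) (auto simp: SL2_def matrix_mul_uminus det_uminus_2)
    moreover have "inv\<^bsub>SL2\<^esub> (mat 1 :: 'a^2^2) = mat 1"
      by (rule inv_equality) (auto simp: SL2_def)
    ultimately show "inv\<^bsub>SL2\<^esub> A \<in> ?Z" if "A \<in> ?Z" for A using that by auto
  qed (auto simp: SL2_def matrix_mul_uminus det_uminus_2)
  show ?thesis
    unfolding normal_def normal_axioms_def
    using sub group_SL2 by (auto simp: r_coset_def l_coset_def SL2_def matrix_mul_uminus)
qed

lemma group_PSL2: "group (PSL2 :: ('a::field^2^2) set monoid)"
  unfolding PSL2_def by (rule normal.factorgroup_is_group[OF normal_SL2_center])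

end

theory Submission
  imports Defs "HOL-Number_Theory.Quadratic_Reciprocity"
begin

text \<open>
  The word \<open>w\<close> has no value of trace \<open>0\<close> in \<open>SL\<^sub>2(q)\<close>, where \<open>q = p\<^bsup>2r+1\<^esup>\<close>. Put
  \<open>X = x\<^sup>2\<close>, \<open>Z = y X\<inverse> y\<inverse>\<close> and \<open>c = X Z = [X\<inverse>, y\<inverse>]\<close>, so that
  \<open>w(x, y) = X c\<^sup>2\<close>. By Cayley--Hamilton, \<open>c\<^sup>2 = t c - 1\<close> with \<open>t = tr c\<close>; hence
  \<open>tr w = t tr(X\<^sup>2 Z) - tr X\<close>. In the same way \<open>tr(X\<^sup>2 Z) = tr X tr(X Z) - tr Z\<close>, and
  \<open>tr Z = tr X\<close> because \<open>Z\<close> is conjugate to \<open>X\<inverse>\<close>. Since \<open>tr X = (tr x)\<^sup>2 - 2\<close>, the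
  trace factors (\<open>trace_word_map_w\<close>):
  \<open>tr w(x, y) = ((tr x)\<^sup>2 - 2) (t\<^sup>2 - t - 1)\<close>.

  A zero of the first factor is a square root of \<open>2\<close> in the field, and a zero of the second
  gives the square root \<open>2 t - 1\<close> of its discriminant \<open>5\<close>. The conditions on \<open>p\<close> say that
  \<open>p\<close> is \<open>\<plusminus>3\<close> modulo \<open>8\<close> and \<open>\<plusminus>2\<close> modulo \<open>5\<close>, so \<open>2\<close> and \<open>5\<close> are nonresidues
  modulo \<open>p\<close> (\<open>Legendre_2_eq_minus_1\<close>, \<open>Legendre_5_eq_minus_1\<close>), and a nonresidue acquires no
  square root in an extension of odd degree (\<open>nonresidue_not_square\<close>).

  The two lifts of an element of \<open>PSL\<^sub>2(q)\<close> differ by a sign, so having trace \<open>0\<close> is a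
  property of the element; the elements that have it are missed by \<open>w\<close>
  (\<open>word_map_PSL2_nonsurj\<close>).
\<close>

section \<open>Quadratic residues modulo \<open>p\<close>\<close>

text \<open>
  Gauss's lemma with multiplier \<open>2\<close>. For \<open>1 \<le> x \<le> h = (p - 1)/2\<close> the doubles \<open>2 x\<close> are
  already reduced modulo \<open>p\<close>, so the sign is decided by the number \<open>h - \<lfloor>h/2\<rfloor>\<close> of those
  exceeding \<open>h\<close>, which is odd for these two residues of \<open>p\<close>.
\<close>
lemma Legendre_2_eq_minus_1:
  fixes p :: nat
  assumes "prime p" and "p mod 8 = 3 \<or> p mod 8 = 5"
  shows "Legendre 2 p = -1"
proof -
  have "p > 2"
    using assms prime_ge_2_nat[of p] by (cases "p = 2") auto
  interpret GAUSS p 2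
    using assms \<open>p > 2\<close> by unfold_locales (auto simp: cong_def)
  obtain k where k: "p = 8 * k + 3 \<or> p = 8 * k + 5"
    using assms(2) mult_div_mod_eq[of 8 p] by metis
  define h where "h = (int p - 1) div 2"
  have h: "int p = 2 * h + 1"
    using p_eq2 by (simp add: h_def)
  have "E = (\<lambda>x. 2 * x) ` {h div 2 <.. h}"
    using h unfolding E_def C_def B_def A_def h_def[symmetric] by (auto simp: image_image)
  then have "card E = nat (h - h div 2)"
    by (simp add: card_image inj_on_def)
  moreover have "nat (h - h div 2) = 2 * k + 1"
    using k h by auto
  ultimately show ?thesis
    using gauss_lemma by simp
qed

text \<open>
  As \<open>5 \<equiv> 1\<close> modulo \<open>4\<close>, reciprocity identifies this symbol with that of \<open>p\<close> modulo \<open>5\<close>,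
  where the nonzero squares are \<open>1\<close> and \<open>4\<close>.
\<close>
lemma Legendre_5_eq_minus_1:
  fixes p :: nat
  assumes "prime p" "p > 2" and "p mod 5 = 2 \<or> p mod 5 = 3"
  shows "Legendre 5 p = -1"
proof -
  have "\<not> [y\<^sup>2 = int p] (mod 5)" for y :: int
  proof
    assume "[y\<^sup>2 = int p] (mod 5)"
    moreover have "int p mod 5 = 2 \<or> int p mod 5 = 3"
      using zmod_int[of p 5] assms(3) by auto
    moreover have "(y mod 5)\<^sup>2 mod 5 = y\<^sup>2 mod 5"
      by (rule power_mod)
    moreover have "y mod 5 \<in> {0..<5}" by simp
    then have "y mod 5 \<in> {0, 1, 2, 3, 4}" by auto
    ultimately show False
      by (auto simp: cong_def)
  qed
  moreover have "\<not> [int p = 0] (mod 5)"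
    using zmod_int[of p 5] assms(3) by (auto simp: cong_def)
  ultimately have "Legendre p 5 = -1"
    by (simp add: Legendre_def QuadRes_def)
  moreover have "p \<noteq> 5" using assms(3) by auto
  then have "Legendre p (int 5) * Legendre (int 5) p = (-1) ^ ((p - 1) div 2 * ((5 - 1) div 2))"
    using assms by (intro Quadratic_Reciprocity) auto
  ultimately show ?thesis by simp
qed


section \<open>Nonresidues in extensions of odd degree\<close>

lemma of_nat_prime_eq_0:
  fixes p n :: nat
  assumes "prime p" and "CARD('a::{field,finite}) = p ^ n"
  shows "of_nat p = (0 :: 'a)"
proof -
  have "of_nat (p ^ n) = (0 :: 'a)"
    using CHAR_dvd_CARD[where 'a = 'a] unfolding assms(2) of_nat_eq_0_iff_char_dvd .
  then show ?thesis by simp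
qed

text \<open>
  Fermat's argument: multiplication by \<open>x \<noteq> 0\<close> permutes the nonzero elements, so comparing
  their product before and after gives \<open>x ^ (q - 1) = 1\<close>.
\<close>
lemma power_card_eq_same:
  fixes x :: "'a::{field,finite}"
  shows "x ^ CARD('a) = x"
proof (cases "x = 0")
  case False
  let ?P = "\<Prod>y\<in>UNIV - {0 :: 'a}. y"
  have "bij_betw ((*) x) (UNIV - {0}) (UNIV - {0})"
    by (rule bij_betw_byWitness[where f' = "\<lambda>y. y / x"]) (use False in auto)
  then have "?P = (\<Prod>y\<in>UNIV - {0}. x * y)"
    by (rule prod.reindex_bij_betw[symmetric])
  also have "\<dots> = x ^ (CARD('a) - 1) * ?P"
    by (simp add: prod.distrib card_Diff_singleton)
  finally have "x ^ (CARD('a) - 1) = 1" by simp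
  moreover have "CARD('a) = Suc (CARD('a) - 1)" by simp
  ultimately show ?thesis by (metis mult.right_neutral power_Suc)
qed simp

lemma of_int_eq_of_cong:
  fixes p :: nat
  assumes "of_nat p = (0 :: 'a::ring_1)" and "[k = l] (mod int p)"
  shows "of_int k = (of_int l :: 'a)"
proof -
  obtain m where "l = k + int p * m"
    using assms(2) by (auto simp: cong_iff_lin)
  then show ?thesis using assms(1) by simp
qed

text \<open>
  If \<open>z\<^sup>2 = d\<close>, then Euler's criterion gives \<open>z ^ p = z d ^ ((p - 1) / 2) = - z\<close>: the
  Frobenius map negates \<open>z\<close>. An odd number of iterations still negates \<open>z\<close>, yet \<open>n\<close> of them
  are the identity on a field with \<open>p ^ n\<close> elements. So \<open>z = 0\<close>, which is absurd since
  \<open>d ^ ((p - 1) / 2) = -1\<close>.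
\<close>
lemma nonresidue_not_square:
  fixes p n :: nat and d :: int and z :: "'a::{field,finite}"
  assumes p: "prime p" "odd p" and card: "CARD('a) = p ^ n" and n: "odd n"
    and d: "Legendre d p = -1"
  shows "z\<^sup>2 \<noteq> of_int d"
proof
  assume z: "z\<^sup>2 = of_int d"
  have p0: "of_nat p = (0 :: 'a)"
    by (rule of_nat_prime_eq_0[OF p(1) card])
  have p2: "p > 2" using p prime_gt_1_nat[OF p(1)] by (cases "p = 2") auto
  have "[-1 = d ^ ((p - 1) div 2)] (mod p)"
    using euler_criterion[OF p(1) p2, of d] d by simp
  from of_int_eq_of_cong[OF p0 this] have half: "(of_int d :: 'a) ^ ((p - 1) div 2) = -1"
    by simp
  have "z ^ p = z * (z\<^sup>2) ^ ((p - 1) div 2)"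
  proof -
    have "p = Suc (2 * ((p - 1) div 2))" using p p2 by presburger
    then show ?thesis by (metis power_Suc power_mult)
  qed
  then have frob: "z ^ p = - z" using z half by simp
  have "z ^ (p ^ m) = (- 1) ^ m * z" for m
  proof (induction m)
    case (Suc m)
    have "z ^ (p ^ Suc m) = (z ^ (p ^ m)) ^ p"
      by (simp add: power_mult[symmetric] mult.commute)
    also have "\<dots> = ((-1) ^ p) ^ m * z ^ p"
      by (simp only: Suc.IH power_mult_distrib) (simp add: power_mult[symmetric] mult.commute)
    finally show ?case using p(2) frob by simp
  qed simp
  from this[of n] have "z ^ CARD('a) = - z"
    using card n by simp
  then have "z = - z" by (simp add: power_card_eq_same)
  then have "2 * z = 0" by (simp add: eq_neg_iff_add_eq_0)
  moreover have "(2 :: 'a) \<noteq> 0"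
  proof
    assume "(2 :: 'a) = 0"
    then have "of_nat (gcd 2 p) = (0 :: 'a)"
      using p0 by (metis of_nat_numeral of_nat_eq_0_iff_char_dvd gcd_greatest)
    moreover have "gcd 2 p = 1" using p(2) by (simp add: coprime_iff_gcd_eq_1[symmetric])
    ultimately show False by simp
  qed
  ultimately have "z = 0" by simp
  with z half p2 have "(0 :: 'a) ^ ((p - 1) div 2) = -1" by simp
  moreover have "(0 :: 'a) ^ ((p - 1) div 2) = 0"
    using p2 by (intro zero_power) auto
  ultimately show False by simp
qed


section \<open>The trace of \<open>w\<close> on SL(2)\<close>

lemma trace_2: "trace A = A$1$1 + A$2$2" for A :: "'a::comm_ring_1^2^2"
  by (simp add: trace_def sum_2)

lemma trace_mat_1_2: "trace (mat 1 :: 'a::comm_ring_1^2^2) = 2"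
  by (simp add: trace_2 mat_def)

text \<open>
  Cayley--Hamilton, \<open>A\<^sup>2 = tr(A) A - det(A) 1\<close>, multiplied by \<open>B\<close>. Together with
  \<open>tr(A B) = tr(B A)\<close> it reduces traces of words in \<open>SL\<^sub>2\<close>: the choices \<open>B = A\<inverse>\<close> and \<open>B = 1\<close> give the
  traces of \<open>A\<inverse>\<close> and \<open>A\<^sup>2\<close>.
\<close>
lemma trace_square_mult:
  fixes A B :: "'a::comm_ring_1^2^2"
  assumes "det A = 1"
  shows "trace (A ** (A ** B)) = trace A * trace (A ** B) - trace B"
proof -
  have "trace (A ** (A ** B)) = trace A * trace (A ** B) - det A * trace B"
    by (simp add: trace_2 det_2 matrix_matrix_mult_def sum_2 algebra_simps)
  then show ?thesis using assms by simp
qed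

lemma trace_inverse:
  fixes A B :: "'a::comm_ring_1^2^2"
  assumes "det A = 1" and "A ** B = mat 1"
  shows "trace B = trace A"
  using trace_square_mult[OF assms(1), of B] assms(2) by (simp add: trace_mat_1_2)

lemma trace_conjugate:
  fixes A B C :: "'a::comm_ring_1^2^2"
  assumes "B ** C = mat 1"
  shows "trace (C ** A ** B) = trace A"
proof -
  have "trace (C ** A ** B) = trace (B ** (C ** A))" by (rule trace_mul_sym)
  then show ?thesis using assms by (simp add: matrix_mul_assoc)
qed

text \<open>
  With \<open>[a, b] = a\<inverse> b\<inverse> a b\<close>, the commutator of \<open>x\<^bsup>-2\<^esup>\<close> and \<open>y\<inverse>\<close> is the product of
  \<open>X = x\<^sup>2\<close> with a conjugate of \<open>X\<inverse>\<close>, so \<open>w\<close> depends on \<open>x\<close> through its square only.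
\<close>
lemma (in group) word_map_w_eq:
  assumes "x \<in> carrier G" "y \<in> carrier G"
  defines "X \<equiv> x \<otimes> x"
  defines "c \<equiv> X \<otimes> (y \<otimes> inv X \<otimes> inv y)"
  shows "word_map G w (x, y) = X \<otimes> (c \<otimes> c)"
proof -
  have "x [^] (-2::int) = inv X"
    using assms by (simp add: int_pow_neg X_def int_pow_def2 numeral_2_eq_2 inv_mult_group)
  moreover have "X \<in> carrier G" using assms by simp
  ultimately show ?thesis
    using assms(1,2) unfolding word_map_w[OF is_group assms(1,2)]
    by (simp add: commutator_def c_def X_def numeral_2_eq_2 m_assoc)
qed

text \<open>
  Cayley--Hamilton is used for \<open>c\<close> and for \<open>X\<close>, after a cyclic shift of \<open>X c c\<close> that brings
  \<open>c c\<close> to the front; the existential quantifier hides \<open>t = tr c\<close>.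
\<close>
lemma trace_word_map_w:
  fixes A B :: "'a::field^2^2"
  assumes A: "A \<in> carrier SL2" and B: "B \<in> carrier SL2"
  shows "\<exists>t. trace (word_map SL2 w (A, B)) = ((trace A)\<^sup>2 - 2) * (t\<^sup>2 - t - 1)"
proof -
  interpret group "SL2 :: ('a^2^2) monoid" by (rule group_SL2)
  have mult: "x \<otimes>\<^bsub>SL2\<^esub> y = x ** y" for x y :: "'a^2^2" by (simp add: SL2_def)
  have det: "det x = 1" if "x \<in> carrier SL2" for x :: "'a^2^2" using that by (simp add: SL2_def)
  have inv: "x ** inv\<^bsub>SL2\<^esub> x = mat 1" "inv\<^bsub>SL2\<^esub> x ** x = mat 1" if "x \<in> carrier SL2" for x :: "'a^2^2"
    using r_inv[OF that] l_inv[OF that] by (simp_all add: SL2_def)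
  define X where "X = A ** A"
  define Z where "Z = B ** inv\<^bsub>SL2\<^esub> X ** inv\<^bsub>SL2\<^esub> B"
  define c where "c = X ** Z"
  have X: "X \<in> carrier SL2" using A m_closed[OF A A] by (simp add: X_def mult)
  have Z: "Z \<in> carrier SL2" using X B by (simp add: Z_def mult[symmetric])
  have c: "c \<in> carrier SL2" using X Z m_closed[OF X Z] by (simp add: c_def mult)
  have trX: "trace X = (trace A)\<^sup>2 - 2"
    using trace_square_mult[OF det[OF A], of "mat 1"]
    by (simp add: X_def trace_mat_1_2 power2_eq_square)
  have "trace Z = trace (inv\<^bsub>SL2\<^esub> X)"
    unfolding Z_def by (rule trace_conjugate) (rule inv(2)[OF B])
  also have "\<dots> = trace X"
    by (rule trace_inverse[OF det[OF X] inv(1)[OF X]])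
  finally have trZ: "trace Z = trace X" .
  have "trace (word_map SL2 w (A, B)) = trace (X ** (c ** c))"
    using word_map_w_eq[OF A B] by (simp add: mult X_def c_def Z_def)
  also have "\<dots> = trace (c ** (c ** X))"
    unfolding matrix_mul_assoc[of c c X] by (rule trace_mul_sym)
  also have "\<dots> = trace c * trace (X ** c) - trace X"
    by (simp add: trace_square_mult[OF det[OF c]] trace_mul_sym[of c X])
  also have "trace (X ** c) = trace X * trace c - trace X"
    using trace_square_mult[OF det[OF X], of Z] trZ by (simp add: c_def)
  also have "trace c * (trace X * trace c - trace X) - trace X = trace X * ((trace c)\<^sup>2 - trace c - 1)"
    by (simp add: algebra_simps power2_eq_square)
  finally show ?thesis using trX by auto
qed


section \<open>The matrices missed by \<open>w\<close>\<close>

lemma word_eval_hom_comp: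
  assumes "group_hom G H h" and f: "range f \<subseteq> carrier G"
  shows "word_eval H (h \<circ> f) u = h (word_eval G f u)"
proof -
  interpret group_hom G H h by fact
  have f': "f g \<in> carrier G" for g using f by auto
  show ?thesis
  proof (induction u)
    case (Cons a u)
    have "word_eval G f u \<in> carrier G" using f by (rule G.word_eval_closed)
    then show ?case using Cons f' by (simp add: word_eval_def)
  qed (simp add: word_eval_def)
qed

text \<open>
  Word maps commute with homomorphisms; applied to the projection of \<open>SL\<^sub>2\<close> onto \<open>PSL\<^sub>2\<close>
  this lets values of a word be computed on lifts.
\<close>
lemma word_map_hom:
  assumes "group_hom G H h" and "x \<in> carrier G" "y \<in> carrier G"
  shows "word_map H u (h x, h y) = h (word_map G u (x, y))"
proof -
  have "case_letter2 (h x) (h y) = h \<circ> case_letter2 x y"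
    by (auto split: letter2.splits)
  moreover have "range (case_letter2 x y) \<subseteq> carrier G"
    using assms by (auto split: letter2.splits)
  ultimately show ?thesis
    using word_eval_hom_comp[OF assms(1), of "case_letter2 x y"] by (simp add: word_map_def)
qed

lemma mem_carrier_PSL2_iff:
  "C \<in> carrier PSL2 \<longleftrightarrow> (\<exists>A\<in>carrier SL2. C = {mat 1, - mat 1} #>\<^bsub>SL2\<^esub> A)"
  for C :: "('a::field^2^2) set"
  by (auto simp: PSL2_def FactGroup_def RCOSETS_def)

lemma PSL2_coset: "{mat 1, - mat 1} #>\<^bsub>SL2\<^esub> A = {A, - A}" for A :: "'a::field^2^2"
  by (auto simp: r_coset_def SL2_def matrix_mul_uminus)

text \<open>
  \<open>SL\<^sub>2\<close> contains a matrix \<open>J\<close> of trace \<open>0\<close>. If the word took the class of \<open>J\<close> as a value,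
  then on lifts of its arguments to \<open>SL\<^sub>2\<close> it would take the value \<open>J\<close> or \<open>- J\<close>, both of trace
  \<open>0\<close>.
\<close>
lemma word_map_PSL2_nonsurj:
  assumes nonzero: "\<And>A B. A \<in> carrier SL2 \<Longrightarrow> B \<in> carrier SL2 \<Longrightarrow>
    trace (word_map SL2 u (A, B)) \<noteq> (0 :: 'a::field)"
  shows "word_map (PSL2 :: ('a^2^2) set monoid) u ` (carrier PSL2 \<times> carrier PSL2) \<noteq> carrier PSL2"
proof
  let ?\<pi> = "\<lambda>A :: 'a^2^2. {mat 1, - mat 1} #>\<^bsub>SL2\<^esub> A"
  assume surj: "word_map (PSL2 :: ('a^2^2) set monoid) u ` (carrier PSL2 \<times> carrier PSL2) = carrier PSL2"
  have hom: "group_hom SL2 PSL2 ?\<pi>"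
    using normal.r_coset_hom_Mod[OF normal_SL2_center[where 'a = 'a]]
      group_SL2 group_PSL2[where 'a = 'a]
    by (simp add: group_hom_def group_hom_axioms_def PSL2_def)
  define J :: "'a^2^2" where "J = vector [vector [0, 1], vector [-1, 0]]"
  have J: "J \<in> carrier SL2" "trace J = 0"
    by (simp_all add: J_def SL2_def det_2 trace_2)
  then have "?\<pi> J \<in> carrier PSL2" by (auto simp: mem_carrier_PSL2_iff)
  then have "?\<pi> J \<in> word_map PSL2 u ` (carrier PSL2 \<times> carrier PSL2)"
    by (simp only: surj)
  then obtain x y where "x \<in> carrier PSL2" "y \<in> carrier PSL2" "?\<pi> J = word_map PSL2 u (x, y)"
    by (elim imageE SigmaE) simp
  then obtain A B where AB: "A \<in> carrier SL2" "B \<in> carrier SL2"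
    and "?\<pi> J = word_map PSL2 u (?\<pi> A, ?\<pi> B)"
    by (auto simp: mem_carrier_PSL2_iff)
  then have "?\<pi> J = ?\<pi> (word_map SL2 u (A, B))"
    using word_map_hom[OF hom AB] by simp
  then have "word_map SL2 u (A, B) = J \<or> word_map SL2 u (A, B) = - J"
    unfolding PSL2_coset by blast
  then have "trace (word_map SL2 u (A, B)) = 0"
  proof
    assume "word_map SL2 u (A, B) = - J"
    then show ?thesis using J(2) by (simp add: trace_2 add_eq_0_iff)
  qed (simp add: J(2))
  then show False using nonzero[OF AB] by simp
qed

theorem corollary3:
  fixes p r :: nat
  assumes "prime p" and "odd p" and "p \<noteq> 5"
    and "\<not> [p^2 = 1] (mod 16)" and "\<not> [p^2 = 1] (mod 5)"
    and "CARD('a::{field,finite}) = p ^ (2 * r + 1)"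
  shows "word_map (PSL2 :: ('a^2^2) set monoid) w `
           (carrier (PSL2 :: ('a^2^2) set monoid) \<times> carrier (PSL2 :: ('a^2^2) set monoid))
         \<noteq> carrier (PSL2 :: ('a^2^2) set monoid)"
proof (rule word_map_PSL2_nonsurj)
  have "p > 2" using \<open>odd p\<close> prime_gt_1_nat[OF \<open>prime p\<close>] by (cases "p = 2") auto
  have "p mod 8 = 3 \<or> p mod 8 = 5"
  proof (rule ccontr)
    assume not35: "\<not> ?thesis"
    \<comment> \<open>Odd numbers congruent to \<open>\<plusminus>1\<close> modulo \<open>8\<close> have square \<open>1\<close> modulo \<open>16\<close>.\<close>
    define k where "k = p div 8"
    have "p mod 8 = 1 \<or> p mod 8 = 7"
      using not35 \<open>odd p\<close> by presburger
    moreover have "p = 8 * k + p mod 8"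
      by (simp add: k_def)
    ultimately have "p = 8 * k + 1 \<or> p = 8 * k + 7"
      by metis
    then have "p\<^sup>2 = 16 * (4 * k * k + k) + 1 \<or> p\<^sup>2 = 16 * (4 * k * k + 7 * k + 3) + 1"
      by (auto simp: power2_eq_square algebra_simps)
    then have "p\<^sup>2 mod 16 = 1"
      by (elim disjE) (simp_all only: mod_mult_self4, simp_all)
    then show False using assms(4) by (simp add: cong_def)
  qed
  then have two: "Legendre 2 p = -1" by (rule Legendre_2_eq_minus_1[OF \<open>prime p\<close>])
  have "p mod 5 = 2 \<or> p mod 5 = 3"
  proof -
    have "p mod 5 \<in> {0..<5}" by simp
    then have "p mod 5 \<in> {0, 1, 2, 3, 4}" by auto
    moreover have "p mod 5 \<noteq> 0"
      using \<open>prime p\<close> \<open>p \<noteq> 5\<close> primes_dvd_imp_eq[of 5 p] by (auto simp: dvd_eq_mod_eq_0)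
    moreover have "(p mod 5)\<^sup>2 mod 5 = p\<^sup>2 mod 5" by (rule power_mod)
    ultimately show ?thesis using assms(5) by (auto simp: cong_def)
  qed
  then have five: "Legendre 5 p = -1"
    by (rule Legendre_5_eq_minus_1[OF \<open>prime p\<close> \<open>p > 2\<close>])
  have nonsquare: "z\<^sup>2 \<noteq> of_int d" if "Legendre d p = -1" for z :: 'a and d
    using nonresidue_not_square[OF \<open>prime p\<close> \<open>odd p\<close> assms(6) _ that] by simp
  fix A B :: "'a^2^2"
  assume "A \<in> carrier SL2" "B \<in> carrier SL2"
  then obtain t where t: "trace (word_map SL2 w (A, B)) = ((trace A)\<^sup>2 - 2) * (t\<^sup>2 - t - 1)"
    using trace_word_map_w by blast
  have "(trace A)\<^sup>2 \<noteq> 2" using nonsquare[OF two] by simp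
  moreover have "t\<^sup>2 - t - 1 \<noteq> 0"
  proof
    assume "t\<^sup>2 - t - 1 = 0"
    \<comment> \<open>Completing the square in \<open>t\<^sup>2 - t - 1\<close>, whose discriminant is \<open>5\<close>.\<close>
    moreover have "(2 * t - 1)\<^sup>2 = 4 * (t\<^sup>2 - t - 1) + 5"
      by (simp add: power2_eq_square algebra_simps)
    ultimately show False using nonsquare[OF five, of "2 * t - 1"] by simp
  qed
  ultimately show "trace (word_map SL2 w (A, B)) \<noteq> 0" using t by simp
qed

end
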